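(* Let $d$ be a positive integer and $t_1,\dots,t_n\in\mathbb{R}$ distinct. Then each of the following matroids equals the polynomial rigidity matroid $\mathcal{P}_d(t_1,\dots,t_n)$: the cofactor rigidity matroid $\mathcal{C}^{d-2}_{d-1}$ of the points $(t_i,t_i^2)$, $i=1,\dots,n$; the bar-and-joint rigidity matroid $\mathcal{R}_d$ of the points $(t_i,t_i^2,\dots,t_i^d)$, $i=1,\dots,n$; and the hyperconnectivity matroid $\mathcal{H}_d$ of the vectors $(1,t_i,\dots,t_i^{d-1})$, $i=1,\dots,n$ (which, if no $t_i$ is zero, equals the hyperconnectivity matroid $\mathcal{H}_d$ of the vectors $(t_i,\dots,t_i^d)$).
   Context: All matrices have rows indexed by $\{i,j\}\in\binom{[n]}{2}$ ($i<j$), $nd$ columns in $n$ blocks of size $d$, and row $\{i,j\}$ zero outside blocks $i,j$; each matroid is the linear matroid of the rows, on ground set $\binom{[n]}{2}$. Bar-and-joint matrix of $\mathbf{p}_1,\dots,\mathbf{p}_n\in\mathbb{R}^d$: $\mathbf{p}_i-\mathbf{p}_j$ in block $i$, $\mathbf{p}_j-\mathbf{p}_i$ in block $j$ (matroid $\mathcal{R}_d(\mathbf{p})$). Hyperconnectivity matrix: $\mathbf{p}_j$ in block $i$, $-\mathbf{p}_i$ in block $j$ (matroid $\mathcal{H}_d(\mathbf{p})$). Cofactor matrix of $\mathbf{q}_1,\dots,\mathbf{q}_n\in\mathbb{R}^2$: with $c(x,y)=(x^{d-1},x^{d-2}y,\dots,y^{d-1})$, block $i$ holds $c(\mathbf{q}_i-\mathbf{q}_j)$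 and block $j$ holds $-c(\mathbf{q}_i-\mathbf{q}_j)$ (matroid $\mathcal{C}^{d-2}_{d-1}(\mathbf{q})$). Polynomial rigidity matrix: for bases $F^i=(f^i_1,\dots,f^i_d)$ of the space $\mathbb{R}[t]_{<d}$ of real polynomials of degree $<d$, block $i$ holds $F^i(t_j)$ and block $j$ holds $-F^j(t_i)$; its row matroid is independent of the choice of bases and is denoted $\mathcal{P}_d(t_1,\dots,t_n)$. *)

theory Defs
  imports "HOL-Computational_Algebra.Polynomial" "HOL-Library.Ramsey"
begin

text \<open>A matroid is represented by its ground set together with its collection of independent
  sets. In the linear matroid of the rows of a matrix, a set of row indices is independent iff the
  corresponding \<^emph>\<open>family\<close> of rows is linearly independent, so equal rows count as parallel elements.\<close>

definition linear_matroid ::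
    "'e set \<Rightarrow> 'c set \<Rightarrow> ('e \<Rightarrow> 'c \<Rightarrow> real) \<Rightarrow> 'e set \<times> 'e set set" where
  "linear_matroid E C M =
     (E, {I. I \<subseteq> E \<and> finite I \<and>
             (\<forall>a. (\<forall>c\<in>C. (\<Sum>e\<in>I. a e * M e c) = 0) \<longrightarrow> (\<forall>e\<in>I. a e = 0))})"

text \<open>Columns are indexed by pairs \<open>(k, l)\<close>, with \<open>k \<in> {1..n}\<close> the block and \<open>l \<in> {1..d}\<close> the
  position in the block. For an edge with end points \<open>i < j\<close>, the vector \<open>A i j\<close> is placed in
  block \<open>i\<close> and \<open>B i j\<close> in block \<open>j\<close>. Vectors of length \<open>d\<close> are functions on \<open>nat\<close> of which only
  the values on \<open>{1..d}\<close> are used.\<close>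

definition block_row ::
    "(nat \<Rightarrow> nat \<Rightarrow> nat \<Rightarrow> real) \<Rightarrow> (nat \<Rightarrow> nat \<Rightarrow> nat \<Rightarrow> real) \<Rightarrow> nat set \<Rightarrow> nat \<times> nat \<Rightarrow> real" where
  "block_row A B e = (\<lambda>(k, l).
     (let i = Min e; j = Max e in
      if k = i then A i j l else if k = j then B i j l else 0))"

definition block_matroid ::
    "nat \<Rightarrow> nat \<Rightarrow> (nat \<Rightarrow> nat \<Rightarrow> nat \<Rightarrow> real) \<Rightarrow> (nat \<Rightarrow> nat \<Rightarrow> nat \<Rightarrow> real)
      \<Rightarrow> nat set set \<times> nat set set set" where
  "block_matroid n d A B = linear_matroid (nsets {1..n} 2) ({1..n} \<times> {1..d}) (block_row A B)"

definition bar_joint_matroid ::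
    "nat \<Rightarrow> nat \<Rightarrow> (nat \<Rightarrow> nat \<Rightarrow> real) \<Rightarrow> nat set set \<times> nat set set set" where
  "bar_joint_matroid n d p =
     block_matroid n d (\<lambda>i j l. p i l - p j l) (\<lambda>i j l. p j l - p i l)"

definition hyperconnectivity_matroid ::
    "nat \<Rightarrow> nat \<Rightarrow> (nat \<Rightarrow> nat \<Rightarrow> real) \<Rightarrow> nat set set \<times> nat set set set" where
  "hyperconnectivity_matroid n d p = block_matroid n d (\<lambda>i j l. p j l) (\<lambda>i j l. - p i l)"

definition cofactor_vector :: "nat \<Rightarrow> real \<times> real \<Rightarrow> nat \<Rightarrow> real" where
  "cofactor_vector d = (\<lambda>(x, y) l. x ^ (d - l) * y ^ (l - 1))"

definition cofactor_matroid ::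
    "nat \<Rightarrow> nat \<Rightarrow> (nat \<Rightarrow> real \<times> real) \<Rightarrow> nat set set \<times> nat set set set" where
  "cofactor_matroid n d q =
     block_matroid n d
       (\<lambda>i j. cofactor_vector d (fst (q i) - fst (q j), snd (q i) - snd (q j)))
       (\<lambda>i j l. - cofactor_vector d (fst (q i) - fst (q j), snd (q i) - snd (q j)) l)"

text \<open>The sequence \<open>f 1, \<dots>, f d\<close> is a basis of the real vector space of polynomials of degree
  less than \<open>d\<close>. As the zero polynomial has degree 0 here, this is intended for positive \<open>d\<close>.\<close>

definition poly_space_basis :: "nat \<Rightarrow> (nat \<Rightarrow> real poly) \<Rightarrow> bool" where
  "poly_space_basis d f \<longleftrightarrow>
     inj_on f {1..d} \<and>
     \<not> module.dependent smult (f ` {1..d}) \<and>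
     module.span smult (f ` {1..d}) = {p. degree p < d}"

text \<open>The matroid defined from the bases \<open>F i\<close> does not depend on their choice; statements about
  the polynomial rigidity matroid are therefore made for arbitrary bases.\<close>

definition polynomial_rigidity_matroid ::
    "nat \<Rightarrow> nat \<Rightarrow> (nat \<Rightarrow> nat \<Rightarrow> real poly) \<Rightarrow> (nat \<Rightarrow> real) \<Rightarrow> nat set set \<times> nat set set set" where
  "polynomial_rigidity_matroid n d F t =
     block_matroid n d (\<lambda>i j l. poly (F i l) (t j)) (\<lambda>i j l. - poly (F j l) (t i))"

end

theory Submission
  imports Defs
begin

text \<open>In block \<open>k\<close>, the dependency equations of the polynomial rigidity matrix say that the
  functional \<open>p \<mapsto> \<Sum> \<plusminus> a\<^sub>k\<^sub>m p(t\<^sub>m)\<close>, summed over the edges \<open>{k, m}\<close>, vanishes on a basis of the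
  polynomials of degree less than \<open>d\<close>. So the matroid does not depend on the bases. The other
  matrices arise, up to non-zero factors on rows and column blocks, from special bases in block \<open>k\<close>:
  the powers of \<open>x + t\<^sub>k\<close> (cofactor), the quotients \<open>(x\<^sup>l - t\<^sub>k\<^sup>l) / (x - t\<^sub>k)\<close> (bar-and-joint)
  and the monomials (hyperconnectivity).\<close>

interpretation poly_module: module "smult :: real \<Rightarrow> real poly \<Rightarrow> real poly"
  by unfold_locales (simp_all add: smult_add_left smult_add_right)

text \<open>Independence depends only on the coefficient vectors of row dependencies, and
  \<open>a \<mapsto> a * s\<close> is a bijection on these that preserves being zero on
  \<open>I\<close>. Hence only the solution sets of the column equations are compared, and the
  column sets \<open>C\<close> and \<open>D\<close> may differ.\<close>

lemma linear_matroid_eq_row_scaleI: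
  assumes nz: "\<And>e. e \<in> E \<Longrightarrow> s e \<noteq> 0"
    and eq: "\<And>I a. I \<subseteq> E \<Longrightarrow> finite I \<Longrightarrow>
      (\<forall>c\<in>C. (\<Sum>e\<in>I. a e * M e c) = 0) \<longleftrightarrow> (\<forall>c\<in>D. (\<Sum>e\<in>I. (a e * s e) * N e c) = 0)"
  shows "linear_matroid E C M = linear_matroid E D N"
proof -
  have "(\<forall>a. (\<forall>c\<in>C. (\<Sum>e\<in>I. a e * M e c) = 0) \<longrightarrow> (\<forall>e\<in>I. a e = 0)) \<longleftrightarrow>
        (\<forall>a. (\<forall>c\<in>D. (\<Sum>e\<in>I. a e * N e c) = 0) \<longrightarrow> (\<forall>e\<in>I. a e = 0))" (is "?L \<longleftrightarrow> ?R")
    if I: "I \<subseteq> E" "finite I" for I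
  proof
    assume L: ?L
    show ?R
    proof (intro allI impI)
      fix a assume a: "\<forall>c\<in>D. (\<Sum>e\<in>I. a e * N e c) = 0"
      have "(\<Sum>e\<in>I. (a e / s e * s e) * N e c) = (\<Sum>e\<in>I. a e * N e c)" for c
        by (rule sum.cong) (use I nz in auto)
      with a have "\<forall>c\<in>C. (\<Sum>e\<in>I. a e / s e * M e c) = 0"
        using eq[OF I, of "\<lambda>e. a e / s e"] by simp
      with L have "\<forall>e\<in>I. a e / s e = 0" by (elim allE[of _ "\<lambda>e. a e / s e"]) simp
      then show "\<forall>e\<in>I. a e = 0" using I nz by auto
    qed
  next
    assume R: ?R
    show ?L
    proof (intro allI impI)
      fix a assume "\<forall>c\<in>C. (\<Sum>e\<in>I. a e * M e c) = 0"
      then have "\<forall>c\<in>D. (\<Sum>e\<in>I. (a e * s e) * N e c) = 0" using eq[OF I] by blast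
      with R have "\<forall>e\<in>I. a e * s e = 0" by (elim allE[of _ "\<lambda>e. a e * s e"]) simp
      then show "\<forall>e\<in>I. a e = 0" using I nz by auto
    qed
  qed
  then show ?thesis unfolding linear_matroid_def by blast
qed

lemma Min_less_Max_nsets_2:
  fixes X :: "'a::linorder set"
  assumes "e \<in> nsets X 2"
  shows "Min e \<in> X" "Max e \<in> X" "Min e < Max e"
proof -
  obtain x y where "e = {x, y}" "x \<in> X" "y \<in> X" "x < y"
    using assms by (auto simp: nsets_2_eq) (metis insert_commute linorder_less_linear)
  then show "Min e \<in> X" "Max e \<in> X" "Min e < Max e" by (auto simp: min_def max_def)
qed

text \<open>The factor \<open>r k\<close> is common to all entries of block \<open>k\<close>, so it
  multiplies whole column equations and leaves their solutions unchanged. The factor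
  \<open>s i j\<close> is common to both blocks of a row, so it is absorbed into the coefficient of
  that row.\<close>

lemma block_matroid_scale:
  assumes A: "\<And>i j l. \<lbrakk>i \<in> {1..n}; j \<in> {1..n}; i < j; l \<in> {1..d}\<rbrakk> \<Longrightarrow> A i j l = r i * (s i j * A' i j l)"
    and B: "\<And>i j l. \<lbrakk>i \<in> {1..n}; j \<in> {1..n}; i < j; l \<in> {1..d}\<rbrakk> \<Longrightarrow> B i j l = r j * (s i j * B' i j l)"
    and r: "\<And>i. i \<in> {1..n} \<Longrightarrow> r i \<noteq> 0"
    and s: "\<And>i j. \<lbrakk>i \<in> {1..n}; j \<in> {1..n}; i < j\<rbrakk> \<Longrightarrow> s i j \<noteq> 0"
  shows "block_matroid n d A B = block_matroid n d A' B'"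
  unfolding block_matroid_def
proof (rule linear_matroid_eq_row_scaleI[where s = "\<lambda>e. s (Min e) (Max e)"])
  fix e assume "e \<in> nsets {1..n} 2"
  from Min_less_Max_nsets_2[OF this] show "s (Min e) (Max e) \<noteq> 0" by (intro s)
next
  fix I and a :: "nat set \<Rightarrow> real"
  assume I: "I \<subseteq> nsets {1..n} 2"
  have "(\<Sum>e\<in>I. a e * block_row A B e c) =
        r (fst c) * (\<Sum>e\<in>I. a e * s (Min e) (Max e) * block_row A' B' e c)"
    if c: "c \<in> {1..n} \<times> {1..d}" for c
    unfolding sum_distrib_left
  proof (rule sum.cong)
    fix e assume "e \<in> I"
    then have "e \<in> nsets {1..n} 2" using I by blast
    note e = Min_less_Max_nsets_2[OF this]
    obtain k l where [simp]: "c = (k, l)" and l: "l \<in> {1..d}" using c by (cases c) auto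
    show "a e * block_row A B e c =
      r (fst c) * (a e * s (Min e) (Max e) * block_row A' B' e c)"
      using A[OF e l] B[OF e l] by (simp add: block_row_def Let_def)
  qed simp
  then show "(\<forall>c\<in>{1..n} \<times> {1..d}. (\<Sum>e\<in>I. a e * block_row A B e c) = 0) \<longleftrightarrow>
    (\<forall>c\<in>{1..n} \<times> {1..d}. (\<Sum>e\<in>I. a e * s (Min e) (Max e) * block_row A' B' e c) = 0)"
    using r by auto
qed

text \<open>A weighted sum of point evaluations is a linear functional of the polynomial, so its
  kernel is a subspace.\<close>

lemma sum_poly_eq_0_on_span:
  assumes "p \<in> module.span smult S" and "\<And>q. q \<in> S \<Longrightarrow> (\<Sum>e\<in>I. w e * poly q (x e)) = (0::real)"
  shows "(\<Sum>e\<in>I. w e * poly p (x e)) = 0"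
  using assms(1)
proof (induction rule: poly_module.span_induct_alt)
  case base
  show ?case by simp
next
  case (step c q p)
  have "(\<Sum>e\<in>I. w e * poly (smult c q + p) (x e)) =
    c * (\<Sum>e\<in>I. w e * poly q (x e)) + (\<Sum>e\<in>I. w e * poly p (x e))"
    by (simp add: sum_distrib_left sum.distrib algebra_simps)
  with step assms(2) show ?case by simp
qed

lemma polynomial_rigidity_matroid_cong_span:
  assumes span: "\<And>k. k \<in> {1..n} \<Longrightarrow>
      module.span smult (F k ` {1..d}) = module.span smult (G k ` {1..d})"
  shows "polynomial_rigidity_matroid n d F t = polynomial_rigidity_matroid n d G t"
  unfolding polynomial_rigidity_matroid_def block_matroid_def
proof (rule linear_matroid_eq_row_scaleI[where s = "\<lambda>_. 1"])
  fix I and a :: "nat set \<Rightarrow> real"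
  \<comment> \<open>For fixed \<open>k\<close>, \<open>w k e\<close> is the signed coefficient of
    the edge \<open>e\<close> and \<open>x k e\<close> the parameter of its other end. If
    \<open>k\<close> is not an end of \<open>e\<close>, the weight is 0, so the value of
    \<open>x k e\<close> is irrelevant.\<close>
  define w where "w k e = (if k = Min e then a e else if k = Max e then - a e else 0)" for k e
  define x where "x k e = t (if k = Min e then Max e else Min e)" for k e
  have row: "a e * block_row (\<lambda>i j l. poly (F i l) (t j)) (\<lambda>i j l. - poly (F j l) (t i)) e (k, l)
      = w k e * poly (F k l) (x k e)" for F :: "nat \<Rightarrow> nat \<Rightarrow> real poly" and e k l
    by (auto simp: block_row_def w_def x_def Let_def)
  \<comment> \<open>\<open>F\<close> and \<open>G\<close> are generalised here so that the
    implication can be applied in both directions.\<close>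
  have imp: "\<forall>l\<in>{1..d}. (\<Sum>e\<in>I. w k e * poly (G k l) (x k e)) = 0"
    if k: "k \<in> {1..n}" and 0: "\<forall>l\<in>{1..d}. (\<Sum>e\<in>I. w k e * poly (F k l) (x k e)) = 0"
      and span: "module.span smult (F k ` {1..d}) = module.span smult (G k ` {1..d})"
    for F G :: "nat \<Rightarrow> nat \<Rightarrow> real poly" and k
  proof
    fix l assume "l \<in> {1..d}"
    then have "G k l \<in> module.span smult (F k ` {1..d})"
      unfolding span by (intro poly_module.span_base) simp
    then show "(\<Sum>e\<in>I. w k e * poly (G k l) (x k e)) = 0"
      by (rule sum_poly_eq_0_on_span) (use 0 in auto)
  qed
  have "(\<forall>l\<in>{1..d}. (\<Sum>e\<in>I. w k e * poly (F k l) (x k e)) = 0) \<longleftrightarrow>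
        (\<forall>l\<in>{1..d}. (\<Sum>e\<in>I. w k e * poly (G k l) (x k e)) = 0)" if "k \<in> {1..n}" for k
    using imp[of k F G, OF that _ span[OF that]] imp[of k G F, OF that _ span[OF that, symmetric]]
    by (rule iffI)
  then show "(\<forall>c\<in>{1..n} \<times> {1..d}. (\<Sum>e\<in>I. a e *
      block_row (\<lambda>i j l. poly (F i l) (t j)) (\<lambda>i j l. - poly (F j l) (t i)) e c) = 0) \<longleftrightarrow>
    (\<forall>c\<in>{1..n} \<times> {1..d}. (\<Sum>e\<in>I. a e * 1 *
      block_row (\<lambda>i j l. poly (G i l) (t j)) (\<lambda>i j l. - poly (G j l) (t i)) e c) = 0)"
    by (simp only: row split_paired_Ball_Sigma mult_1_right cong: ball_cong)
qed simp

text \<open>There is one polynomial of each degree below \<open>d\<close>, so leading terms can be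
  cancelled successively. Nonvanishing has to be stated separately for \<open>l = 1\<close>, since
  the zero polynomial also has degree 0.\<close>

lemma span_poly_triangular:
  fixes g :: "nat \<Rightarrow> real poly"
  assumes "d > 0"
    and deg: "\<And>l. l \<in> {1..d} \<Longrightarrow> degree (g l) = l - 1"
    and nz: "\<And>l. l \<in> {1..d} \<Longrightarrow> g l \<noteq> 0"
  shows "module.span smult (g ` {1..d}) = {p. degree p < d}"
proof
  show "module.span smult (g ` {1..d}) \<subseteq> {p. degree p < d}"
  proof
    fix p assume "p \<in> module.span smult (g ` {1..d})"
    then show "p \<in> {p. degree p < d}"
    proof (induction rule: poly_module.span_induct_alt)
      case base
      show ?case using \<open>d > 0\<close> by simp
    next
      case (step c q p)
      then obtain l where "l \<in> {1..d}" "q = g l" by auto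
      then have "degree q < d" using deg[of l] by auto
      then have "degree (smult c q) < d" using degree_smult_le le_less_trans by blast
      then show ?case using step by (auto intro: degree_add_less)
    qed
  qed
  have "p \<in> module.span smult (g ` {1..d})" if "degree p < d" for p
    using that
  proof (induction "degree p" arbitrary: p rule: less_induct)
    case (less p)
    \<comment> \<open>The shift matches the indexing from 1: \<open>g l\<close> has degree
      \<open>l - 1\<close>, which is the degree of \<open>p\<close>.\<close>
    define l where "l = Suc (degree p)"
    have l: "l \<in> {1..d}" using less.prems by (auto simp: l_def)
    have gl: "g l \<in> module.span smult (g ` {1..d})"
      by (rule poly_module.span_base) (use l in simp)
    have dl: "degree (g l) = degree p"
      using deg[OF l] by (simp add: l_def)
    have nl: "lead_coeff (g l) \<noteq> 0"
      using nz[OF l] by (simp only: leading_coeff_0_iff not_False_eq_True)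
    define c where "c = lead_coeff p / lead_coeff (g l)"
    define q where "q = p - smult c (g l)"
    have p: "p = q + smult c (g l)" by (simp add: q_def)
    have "degree q \<le> degree p" unfolding q_def
      by (rule degree_diff_le) (use dl degree_smult_le[of c "g l"] in auto)
    moreover have "coeff q (degree p) = 0" using nl by (simp add: q_def c_def dl)
    ultimately have "q = 0 \<or> degree q < degree p"
      by (metis le_neq_implies_less leading_coeff_0_iff)
    then have "q \<in> module.span smult (g ` {1..d})"
      using less.hyps[of q] less.prems poly_module.span_zero by auto
    then show ?case
      by (subst p) (intro poly_module.span_add poly_module.span_scale gl)
  qed
  then show "{p. degree p < d} \<subseteq> module.span smult (g ` {1..d})" by blast
qed

theorem theorem2p5:
  fixes n d :: nat and t :: "nat \<Rightarrow> real" and F :: "nat \<Rightarrow> nat \<Rightarrow> real poly"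
  assumes "d > 0"
    and "inj_on t {1..n}"
    and "\<And>i. i \<in> {1..n} \<Longrightarrow> poly_space_basis d (F i)"
  shows "cofactor_matroid n d (\<lambda>i. (t i, (t i)\<^sup>2)) = polynomial_rigidity_matroid n d F t
    \<and> bar_joint_matroid n d (\<lambda>i l. t i ^ l) = polynomial_rigidity_matroid n d F t
    \<and> hyperconnectivity_matroid n d (\<lambda>i l. t i ^ (l - 1)) = polynomial_rigidity_matroid n d F t
    \<and> ((\<forall>i\<in>{1..n}. t i \<noteq> 0) \<longrightarrow>
         hyperconnectivity_matroid n d (\<lambda>i l. t i ^ (l - 1)) =
         hyperconnectivity_matroid n d (\<lambda>i l. t i ^ l))"
proof (intro conjI impI)
  have change_basis: "polynomial_rigidity_matroid n d G t = polynomial_rigidity_matroid n d F t"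
    if "\<And>k l. l \<in> {1..d} \<Longrightarrow> degree (G k l) = l - 1" "\<And>k l. l \<in> {1..d} \<Longrightarrow> G k l \<noteq> 0" for G
    by (rule polynomial_rigidity_matroid_cong_span)
      (use assms(3) that span_poly_triangular[OF \<open>d > 0\<close>] in \<open>auto simp: poly_space_basis_def\<close>)
  have t_neq: "t i \<noteq> t j" if "i \<in> {1..n}" "j \<in> {1..n}" "i < j" for i j
    using inj_onD[OF assms(2), of i j] that by auto

  show "cofactor_matroid n d (\<lambda>i. (t i, (t i)\<^sup>2)) = polynomial_rigidity_matroid n d F t"
  proof -
    define G where "G k l = [:t k, 1:] ^ (l - 1)" for k l :: nat
    \<comment> \<open>Both coordinates of the difference contain \<open>t i - t j\<close>, and
      \<open>cofactor_vector\<close> is homogeneous of degree \<open>d - 1\<close>; the extracted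
      power is therefore the same for all \<open>l\<close>. The remaining factor is symmetric in
      \<open>i\<close> and \<open>j\<close>, so it is the value of \<open>G i l\<close> at
      \<open>t j\<close> and of \<open>G j l\<close> at \<open>t i\<close>.\<close>
    have entry: "cofactor_vector d (t i - t j, (t i)\<^sup>2 - (t j)\<^sup>2) l =
        (t i - t j) ^ (d - 1) * (t i + t j) ^ (l - 1)" if "l \<in> {1..d}" for i j l
    proof -
      have sq: "(t i)\<^sup>2 - (t j)\<^sup>2 = (t i - t j) * (t i + t j)"
        by (simp add: power2_eq_square algebra_simps)
      have "d - 1 = (d - l) + (l - 1)" using that by auto
      then have "(t i - t j) ^ (d - 1) = (t i - t j) ^ (d - l) * (t i - t j) ^ (l - 1)"
        by (metis power_add)
      then show ?thesis by (simp add: cofactor_vector_def sq power_mult_distrib)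
    qed
    have "cofactor_matroid n d (\<lambda>i. (t i, (t i)\<^sup>2)) = polynomial_rigidity_matroid n d G t"
      unfolding cofactor_matroid_def polynomial_rigidity_matroid_def
      by (rule block_matroid_scale[where r = "\<lambda>_. 1" and s = "\<lambda>i j. (t i - t j) ^ (d - 1)"])
        (use t_neq in \<open>auto simp: entry G_def add.commute\<close>)
    also have "\<dots> = polynomial_rigidity_matroid n d F t"
      by (rule change_basis) (simp_all add: G_def degree_linear_power)
    finally show ?thesis .
  qed

  show "bar_joint_matroid n d (\<lambda>i l. t i ^ l) = polynomial_rigidity_matroid n d F t"
  proof -
    \<comment> \<open>This is the quotient of \<open>x ^ l - t k ^ l\<close> by
      \<open>x - t k\<close>, written out as a geometric sum so that it is also defined at
      \<open>x = t k\<close> and its coefficients can be read off.\<close>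
    define G where "G k l = (\<Sum>m<l. monom (t k ^ (l - Suc m)) m)" for k l :: nat
    have poly_G: "t j ^ l - t k ^ l = (t j - t k) * poly (G k l) (t j)" for j k l
      by (simp add: G_def poly_sum poly_monom power_diff_sumr2 mult.commute)
    have coeff_G: "coeff (G k l) m = (if m < l then t k ^ (l - Suc m) else 0)" for k l m
      by (simp add: G_def coeff_sum)
    have "bar_joint_matroid n d (\<lambda>i l. t i ^ l) = polynomial_rigidity_matroid n d G t"
      unfolding bar_joint_matroid_def polynomial_rigidity_matroid_def
    proof (rule block_matroid_scale[where r = "\<lambda>_. 1" and s = "\<lambda>i j. t i - t j"])
      fix i j l
      show "t i ^ l - t j ^ l = 1 * ((t i - t j) * poly (G i l) (t j))"
        using poly_G[of j l i] by (simp add: algebra_simps)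
      show "t j ^ l - t i ^ l = 1 * ((t i - t j) * - poly (G j l) (t i))"
        using poly_G[of i l j] by (simp add: algebra_simps)
    qed (use t_neq in auto)
    also have "\<dots> = polynomial_rigidity_matroid n d F t"
    proof (rule change_basis)
      fix k l assume l: "l \<in> {1..d}"
      \<comment> \<open>The top coefficient is \<open>t k ^ 0\<close>, hence 1 even if
        \<open>t k = 0\<close>.\<close>
      have 1: "coeff (G k l) (l - 1) = 1" using l by (simp add: coeff_G)
      then show "G k l \<noteq> 0" by auto
      show "degree (G k l) = l - 1"
      proof (rule antisym)
        show "degree (G k l) \<le> l - 1" by (rule degree_le) (auto simp: coeff_G)
        show "l - 1 \<le> degree (G k l)" by (rule le_degree) (simp only: 1 one_neq_zero not_False_eq_True)
      qed
    qed
    finally show ?thesis .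
  qed

  show "hyperconnectivity_matroid n d (\<lambda>i l. t i ^ (l - 1)) = polynomial_rigidity_matroid n d F t"
  proof -
    have "hyperconnectivity_matroid n d (\<lambda>i l. t i ^ (l - 1)) =
        polynomial_rigidity_matroid n d (\<lambda>k l. monom 1 (l - 1)) t"
      by (simp add: hyperconnectivity_matroid_def polynomial_rigidity_matroid_def poly_monom)
    also have "\<dots> = polynomial_rigidity_matroid n d F t"
      by (rule change_basis) (simp_all add: degree_monom_eq)
    finally show ?thesis .
  qed

  show "hyperconnectivity_matroid n d (\<lambda>i l. t i ^ (l - 1)) =
      hyperconnectivity_matroid n d (\<lambda>i l. t i ^ l)" if "\<forall>i\<in>{1..n}. t i \<noteq> 0"
    unfolding hyperconnectivity_matroid_def
  \<comment> \<open>Block \<open>i\<close> holds the vector of \<open>j\<close>. Dividing the row by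
    \<open>t i * t j\<close> lowers the exponent of \<open>t j\<close> by one and leaves a factor
    \<open>1 / t i\<close>, which the column factor \<open>t i\<close> of block \<open>i\<close>
    cancels; block \<open>j\<close> is symmetric.\<close>
  proof (rule block_matroid_scale[where r = t and s = "\<lambda>i j. inverse (t i * t j)"])
    fix i j l assume *: "i \<in> {1..n}" "j \<in> {1..n}" "l \<in> {1..d}"
    \<comment> \<open>Since \<open>l\<close> starts at 1, the subtraction \<open>l - 1\<close> is
      not truncated.\<close>
    then have "t k ^ l = t k * t k ^ (l - 1)" for k by (cases l) auto
    then show "t j ^ (l - 1) = t i * (inverse (t i * t j) * t j ^ l)"
      and "- (t i ^ (l - 1)) = t j * (inverse (t i * t j) * - (t i ^ l))"
      using that * by (simp_all add: field_simps)
  qed (use that in auto)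
qed

end
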